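(* Let $q$ be an odd prime power and $0<u\le1$. For $G\in\{Sp,O\}$ let $P_{G,u}(j)$ be the probability that a partition chosen from the measure $M_{G,u}$ has exactly $j$ parts. Then for every integer $k\ge0$: $$P_{Sp,u}(2k)=\prod_{i=1}^{\infty}\Bigl(1-\frac{u^2}{q^{2i-1}}\Bigr)\cdot\frac{u^{2k}}{q^{2k^2+k}\prod_{i=1}^{k}(1-u^2/q^{2i-1})(1-1/q^{2i})},$$ $$P_{Sp,u}(2k+1)=\prod_{i=1}^{\infty}\Bigl(1-\frac{u^2}{q^{2i-1}}\Bigr)\cdot\frac{u^{2k+2}}{q^{2k^2+3k+1}\prod_{i=1}^{k+1}(1-u^2/q^{2i-1})\prod_{i=1}^{k}(1-1/q^{2i})},$$ $$P_{O,u}(2k)=\frac{\prod_{i=1}^{\infty}(1-u^2/q^{2i-1})}{1+u}\cdot\frac{u^{2k}}{q^{2k^2-k}\prod_{i=1}^{k}(1-u^2/q^{2i-1})(1-1/q^{2i})},$$ $$P_{O,u}(2k+1)=\frac{\prod_{i=1}^{\infty}(1-u^2/q^{2i-1})}{1+u}\cdot\frac{u^{2k+1}}{q^{2k^2+k}\prod_{i=1}^{k+1}(1-u^2/q^{2i-1})\prod_{i=1}^{k}(1-1/q^{2i})}.$$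
   Context: For a partition $\lambda$, $m_i=m_i(\lambda)$ is the number of parts equal to $i$, $\lambda_i'=m_i+m_{i+1}+\cdots$ is the length of the $i$-th column of its diagram (so $\lambda_1'$ is the number of parts), and $|\lambda|$ is the sum of its parts. The measures $M_{Sp,u}$ and $M_{O,u}$ on the set of all partitions of all non-negative integers are as follows. $M_{Sp,u}(\lambda)=0$ unless every odd part of $\lambda$ has even multiplicity, in which case $$M_{Sp,u}(\lambda)=\prod_{r=1}^{\infty}\Bigl(1-\frac{u^2}{q^{2r-1}}\Bigr)\,\frac{u^{|\lambda|}}{q^{\frac12\left[\sum_i(\lambda_i')^2-\sum_i m_i^2\right]}\prod_{i\ge1}a_i},$$ where - if $i$ is odd: $a_i=q^{m_i^2/4}\prod_{l=1}^{m_i/2}(q^{2l}-1)$; - if $i$ is even and $m_i$ is even: $a_i=q^{m_i^2/4-m_i/2}\prod_{l=1}^{m_i/2}(q^{2l}-1)$; - if $i$ is even and $m_i$ is odd: $a_i=q^{(m_i^2+1)/4}\prod_{l=1}^{(m_i-1)/2}(q^{2l}-1)$. $M_{O,u}(\lambda)=0$ unless every even part of $\lambda$ has even multiplicity, in which case $$M_{O,u}(\lambda)=\frac{1}{1+u}\prod_{r=1}^{\infty}\Bigl(1-\frac{u^2}{q^{2r-1}}\Bigr)\,\frac{u^{|\lambda|}}{q^{\frac12\left[\sum_i(\lambda_i')^2-\sum_i m_i^2\right]}\prod_{i\ge1}c_i},$$ where - if $i$ is even: $c_i=q^{m_i^2/4-m_i/2}\prod_{l=1}^{m_i/2}(q^{2l}-1)$;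 - if $i$ is odd and $m_i$ is even: $c_i=q^{m_i^2/4-m_i}\prod_{l=1}^{m_i/2}(q^{2l}-1)$; - if $i$ is odd and $m_i$ is odd: $c_i=q^{(m_i-1)^2/4}\prod_{l=1}^{(m_i-1)/2}(q^{2l}-1)$. Here $P_{G,u}(j)=\sum_{\lambda:\lambda_1'=j}M_{G,u}(\lambda)$. *)

theory Defs
  imports
    "HOL-Library.Multiset"
    "HOL-Number_Theory.Prime_Powers"
    "HOL-Analysis.Analysis"
begin

text \<open>
  A partition is the multiset of its (positive) parts, so that \<open>count \<mu> i\<close> is the
  multiplicity of the part \<open>i\<close> and \<open>sum_mset \<mu>\<close> is the size of \<open>\<mu>\<close>.
\<close>

definition partitions :: "nat multiset set" where
  "partitions = {\<mu>. 0 \<notin># \<mu>}"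

definition column_length :: "nat multiset \<Rightarrow> nat \<Rightarrow> nat" where
  "column_length \<mu> i = (\<Sum>j | j \<in># \<mu> \<and> i \<le> j. count \<mu> j)"

text \<open>
  No part of \<open>\<mu>\<close> exceeds \<open>sum_mset \<mu>\<close>. Hence for \<open>i > sum_mset \<mu>\<close> both \<open>count \<mu> i\<close> and
  \<open>column_length \<mu> i\<close> vanish, and the factors \<open>a_factor q i 0\<close> and \<open>c_factor q i 0\<close> are \<open>1\<close>;
  sums and products over all \<open>i \<ge> 1\<close> are therefore taken over \<open>1 \<le> i \<le> sum_mset \<mu>\<close>.
  The exponents of \<open>q\<close> can be negative or half-integral.
\<close>

definition q_exponent :: "nat multiset \<Rightarrow> real" where
  "q_exponent \<mu> =
     ((\<Sum>i=1..sum_mset \<mu>. (real (column_length \<mu> i))\<^sup>2)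
      - (\<Sum>i=1..sum_mset \<mu>. (real (count \<mu> i))\<^sup>2)) / 2"

text \<open>
  Where \<open>M_Sp\<close> (resp. \<open>M_O\<close>) does not vanish, an odd (resp. even) \<open>i\<close> has even multiplicity \<open>m\<close>,
  so the first branch of \<open>a_factor\<close> (resp. \<open>c_factor\<close>) only matters for even \<open>m\<close>.
\<close>

definition a_factor :: "real \<Rightarrow> nat \<Rightarrow> nat \<Rightarrow> real" where
  "a_factor q i m =
     (if odd i then
        q powr ((real m)\<^sup>2 / 4) * (\<Prod>l=1..m div 2. (q ^ (2 * l) - 1))
      else if even m then
        q powr ((real m)\<^sup>2 / 4 - real m / 2) * (\<Prod>l=1..m div 2. (q ^ (2 * l) - 1))
      else
        q powr (((real m)\<^sup>2 + 1) / 4) * (\<Prod>l=1..(m - 1) div 2. (q ^ (2 * l) - 1)))"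

definition c_factor :: "real \<Rightarrow> nat \<Rightarrow> nat \<Rightarrow> real" where
  "c_factor q i m =
     (if even i then
        q powr ((real m)\<^sup>2 / 4 - real m / 2) * (\<Prod>l=1..m div 2. (q ^ (2 * l) - 1))
      else if even m then
        q powr ((real m)\<^sup>2 / 4 - real m) * (\<Prod>l=1..m div 2. (q ^ (2 * l) - 1))
      else
        q powr ((real m - 1)\<^sup>2 / 4) * (\<Prod>l=1..(m - 1) div 2. (q ^ (2 * l) - 1)))"

text \<open>\<open>prodinf\<close> is indexed from \<open>0\<close>, so the exponent \<open>2r - 1\<close> for \<open>r \<ge> 1\<close> becomes \<open>2r + 1\<close>.\<close>

definition euler_product :: "real \<Rightarrow> real \<Rightarrow> real" where
  "euler_product q u = (\<Prod>r. (1 - u\<^sup>2 / q ^ (2 * r + 1)))"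

definition M_Sp :: "real \<Rightarrow> real \<Rightarrow> nat multiset \<Rightarrow> real" where
  "M_Sp q u \<mu> =
     (if \<forall>i\<in>#\<mu>. odd i \<longrightarrow> even (count \<mu> i) then
        euler_product q u * (u ^ sum_mset \<mu> /
          (q powr q_exponent \<mu> * (\<Prod>i=1..sum_mset \<mu>. a_factor q i (count \<mu> i))))
      else 0)"

definition M_O :: "real \<Rightarrow> real \<Rightarrow> nat multiset \<Rightarrow> real" where
  "M_O q u \<mu> =
     (if \<forall>i\<in>#\<mu>. even i \<longrightarrow> even (count \<mu> i) then
        1 / (1 + u) * euler_product q u * (u ^ sum_mset \<mu> /
          (q powr q_exponent \<mu> * (\<Prod>i=1..sum_mset \<mu>. c_factor q i (count \<mu> i))))
      else 0)"

definition P_Sp :: "real \<Rightarrow> real \<Rightarrow> nat \<Rightarrow> real" where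
  "P_Sp q u j = (\<Sum>\<^sub>\<infinity>\<mu>\<in>{\<mu> \<in> partitions. column_length \<mu> 1 = j}. M_Sp q u \<mu>)"

definition P_O :: "real \<Rightarrow> real \<Rightarrow> nat \<Rightarrow> real" where
  "P_O q u j = (\<Sum>\<^sub>\<infinity>\<mu>\<in>{\<mu> \<in> partitions. column_length \<mu> 1 = j}. M_O q u \<mu>)"

end

theory Submission
  imports Defs
begin

text \<open>
  Removing the first column of a partition with \<open>j\<close> parts leaves a partition with \<open>l \<le> j\<close> parts
  and exchanges the two parity conditions. Up to the factor \<open>q powr (\<plusminus>l / 2)\<close> it also exchanges the
  local factors \<open>a\<^sub>i\<close> and \<open>c\<^sub>i\<close>, so the sums over partitions with \<open>j\<close> parts and bounded largest part
  obey a coupled linear recursion. With \<open>p = 1 / q\<^sup>2\<close> and \<open>x = u\<^sup>2 / q\<close>, the claimed values are a fixed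
  point of the recursion: all four cases reduce to the \<open>q\<close>-Vandermonde identity
  \<open>\<Sum>h\<le>k. x\<^sup>h p\<^bsup>h(h-1)\<^esup> / ((x;p)\<^sub>h (p;p)\<^sub>h (p;p)\<^bsub>k-h\<^esub>) = 1 / ((x;p)\<^sub>k (p;p)\<^sub>k)\<close>.
  The recursion is positive, so the truncated sums increase and stay below the fixed point. Its
  diagonal product is below \<open>1\<close>, so the fixed point is unique and must be the limit.
\<close>

section \<open>A \<open>q\<close>-Vandermonde identity\<close>

definition q_poch :: "real \<Rightarrow> real \<Rightarrow> nat \<Rightarrow> real" where
  "q_poch p x n = (\<Prod>i<n. 1 - x * p ^ i)"

lemma q_poch_0 [simp]: "q_poch p x 0 = 1"
  by (simp add: q_poch_def)

lemma q_poch_Suc: "q_poch p x (Suc n) = q_poch p x n * (1 - x * p ^ n)"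
  by (simp add: q_poch_def)

lemma q_poch_Suc_shift: "q_poch p x (Suc n) = (1 - x) * q_poch p (x * p) n"
  by (simp only: q_poch_def prod.lessThan_Suc_shift) (simp add: mult_ac)

lemma q_poch_pos:
  assumes "0 \<le> p" "p \<le> 1" "x < 1"
  shows "0 < q_poch p x n"
  unfolding q_poch_def
proof (rule prod_pos, safe)
  fix i
  have "0 \<le> p ^ i" "p ^ i \<le> 1"
    using assms by (auto intro: power_le_one)
  then show "0 < 1 - x * p ^ i"
    using assms by (smt (verit) mult_less_cancel_right2 mult_nonpos_nonneg mult_left_le)
qed

text \<open>Write \<open>1 - p ^ Suc k\<close> as
  \<open>(1 - p ^ (Suc k - h)) + p ^ (Suc k - h) * (1 - p ^ h)\<close> in the \<open>h\<close>-th
  summand. The first piece cancels the last factor of \<open>q_poch p p (Suc k - h)\<close> and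
  leaves the sum for \<open>k\<close> at \<open>x\<close>. The second cancels the last factor of
  \<open>q_poch p p h\<close> and leaves the sum for \<open>k\<close> at \<open>x * p\<close>, which
  is why \<open>x\<close> is arbitrary in the induction.\<close>

lemma q_vandermonde:
  assumes p: "0 < p" "p < 1" and "0 \<le> x" "x < 1"
  shows "(\<Sum>h\<le>k. x ^ h * p ^ (h * (h - 1)) / (q_poch p x h * q_poch p p h * q_poch p p (k - h)))
       = 1 / (q_poch p x k * q_poch p p k)"
  using \<open>0 \<le> x\<close> \<open>x < 1\<close>
proof (induction k arbitrary: x)
  case 0
  then show ?case by simp
next
  case (Suc k)
  define G where "G = (\<lambda>k x. \<Sum>h\<le>k. x ^ h * p ^ (h * (h - 1)) / (q_poch p x h * q_poch p p h * q_poch p p (k - h)))"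
  have xp: "0 \<le> x * p" "x * p < 1"
    using Suc.prems p by (simp, smt (verit) mult_left_le)
  have pos: "0 < q_poch p x n" "0 < q_poch p p n" "0 < q_poch p (x * p) n" for n
    using p Suc.prems xp by (auto intro!: q_poch_pos)
  have pk: "p ^ Suc n < 1" for n
    using p by (intro power_Suc_less_one) auto
  define D where "D = (\<lambda>h. x ^ h * p ^ (h * (h - 1)) / (q_poch p x h * q_poch p p h * q_poch p p (Suc k - h)))"
  have "(1 - p ^ Suc k) * G (Suc k) x
      = (\<Sum>h\<le>Suc k. (1 - p ^ (Suc k - h)) * D h) + (\<Sum>h\<le>Suc k. p ^ (Suc k - h) * (1 - p ^ h) * D h)"
    unfolding G_def sum_distrib_left D_def[symmetric] sum.distrib[symmetric]
  proof (rule sum.cong[OF refl])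
    fix h assume "h \<in> {..Suc k}"
    then have "p ^ Suc k = p ^ (Suc k - h) * p ^ h"
      by (metis atMost_iff le_add_diff_inverse2 power_add)
    then show "(1 - p ^ Suc k) * D h = (1 - p ^ (Suc k - h)) * D h + p ^ (Suc k - h) * (1 - p ^ h) * D h"
      by (simp add: algebra_simps)
  qed
  also have "(\<Sum>h\<le>Suc k. (1 - p ^ (Suc k - h)) * D h) = G k x"
  proof -
    have "(1 - p ^ (Suc k - h)) * D h = x ^ h * p ^ (h * (h - 1)) / (q_poch p x h * q_poch p p h * q_poch p p (k - h))"
      if "h \<le> k" for h
      using pk[of "k - h"] that pos[of "k-h"] pos[of h]
      by (simp add: D_def Suc_diff_le q_poch_Suc divide_simps)
    then show ?thesis
      by (simp add: G_def)
  qed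
  \<comment> \<open>The term \<open>h = 0\<close> vanishes, so the index moves up by one. Splitting
    off the first factor of \<open>q_poch p x (Suc h)\<close> produces \<open>1 - x\<close> and the
    argument \<open>x * p\<close>.\<close>
  also have "(\<Sum>h\<le>Suc k. p ^ (Suc k - h) * (1 - p ^ h) * D h) = x * p ^ k / (1 - x) * G k (x * p)"
  proof -
    have "p ^ (k - h) * (1 - p ^ Suc h) * D (Suc h) = x * p ^ k / (1 - x) *
        ((x * p) ^ h * p ^ (h * (h - 1)) / (q_poch p (x * p) h * q_poch p p h * q_poch p p (k - h)))"
      if "h \<le> k" for h
    proof -
      have e: "p ^ (k - h) * p ^ (Suc h * h) = p ^ k * p ^ h * p ^ (h * (h - 1))"
      proof -
        have "k - h + Suc h * h = k + h + h * (h - 1)"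
          using that by (cases h) (auto simp: algebra_simps)
        then show ?thesis unfolding power_add[symmetric] by (simp only:)
      qed
      have "p ^ (k - h) * (1 - p ^ Suc h) * D (Suc h)
         = (p ^ (k - h) * p ^ (Suc h * h)) * (x * x ^ h) * (1 - p ^ Suc h) /
           ((1 - x) * q_poch p (x * p) h * (q_poch p p h * (1 - p ^ Suc h)) * q_poch p p (k - h))"
        by (simp add: D_def q_poch_Suc[of p p] q_poch_Suc_shift[of p x] mult_ac)
      also have "\<dots> = x * p ^ k / (1 - x) *
        ((x * p) ^ h * p ^ (h * (h - 1)) / (q_poch p (x * p) h * q_poch p p h * q_poch p p (k - h)))"
        unfolding e using pk[of h] by (simp add: power_mult_distrib mult_ac)
      finally show ?thesis .
    qed
    then show ?thesis
      by (simp del: power_Suc sum.atMost_Suc add: sum.atMost_Suc_shift G_def sum_distrib_left)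
  qed
  also have "G k x + x * p ^ k / (1 - x) * G k (x * p)
     = 1 / (q_poch p x k * q_poch p p k) + x * p ^ k / (q_poch p x (Suc k) * q_poch p p k)"
    using Suc.IH[OF Suc.prems] Suc.IH[OF xp] by (simp add: G_def q_poch_Suc_shift)
  \<comment> \<open>Over the common denominator \<open>q_poch p x (Suc k) * q_poch p p k\<close> the
    numerators are \<open>1 - x * p ^ k\<close> and \<open>x * p ^ k\<close>, with sum 1.\<close>
  also have "\<dots> = (1 - p ^ Suc k) * (1 / (q_poch p x (Suc k) * q_poch p p (Suc k)))"
    using pos(1)[of k] pos(2)[of k] pos(1)[of "Suc k"] pk[of k]
    by (auto simp: q_poch_Suc divide_simps)
  finally have "G (Suc k) x = 1 / (q_poch p x (Suc k) * q_poch p p (Suc k))"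
    by (rule mult_left_cancel[THEN iffD1, rotated]) (use pk[of k] in simp)
  then show ?case
    by (simp only: G_def)
qed

text \<open>This is the preceding identity at \<open>x * p\<close>, divided by \<open>1 - x\<close>.
  The extra \<open>p ^ h\<close> from \<open>(x * p) ^ h\<close> raises the exponent
  \<open>h * (h - 1)\<close> to \<open>h * h\<close>. It serves the odd numbers of parts.\<close>

lemma q_vandermonde_shifted:
  assumes p: "0 < p" "p < 1" and x: "0 \<le> x" "x < 1"
  shows "(\<Sum>h\<le>k. x ^ h * p ^ (h * h) / (q_poch p x (Suc h) * q_poch p p h * q_poch p p (k - h)))
       = 1 / (q_poch p x (Suc k) * q_poch p p k)"
proof -
  have "x * p < 1"
    using x p by (smt (verit) mult_left_le)
  then have "1 / (1 - x) * (\<Sum>h\<le>k. (x * p) ^ h * p ^ (h * (h - 1)) /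
        (q_poch p (x * p) h * q_poch p p h * q_poch p p (k - h)))
      = 1 / (1 - x) * (1 / (q_poch p (x * p) k * q_poch p p k))"
    using x p by (subst q_vandermonde) auto
  moreover have "(x * p) ^ h * p ^ (h * (h - 1)) = x ^ h * p ^ (h * h)" for h
    by (cases h) (simp_all add: power_mult_distrib power_add)
  ultimately show ?thesis
    by (simp add: q_poch_Suc_shift sum_distrib_left mult.assoc)
qed

section \<open>Limits of positive recursions\<close>

text \<open>Positivity makes \<open>X\<close> increasing in \<open>N\<close> and bounded by
  \<open>s\<close>, so it has a limit \<open>L\<close>, which solves the same equations as
  \<open>s\<close>. By strong induction on \<open>j\<close>, only the diagonal term survives in
  \<open>s - L\<close>, and two applications of the recursion multiply this difference by a number
  below 1.\<close>

lemma coupled_recursion_limit: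
  fixes A X :: "bool \<Rightarrow> nat \<Rightarrow> nat \<Rightarrow> real" and s :: "bool \<Rightarrow> nat \<Rightarrow> real"
  assumes nonneg: "\<And>b j l. 0 \<le> A b j l" "\<And>b j. 0 \<le> s b j"
    and init: "\<And>b j. X b 0 j = (if j = 0 then 1 else 0)"
    and rec: "\<And>b N j. X b (Suc N) j = (\<Sum>l\<le>j. A b j l * X (\<not> b) N l)"
    and fix_s: "\<And>b j. s b j = (\<Sum>l\<le>j. A b j l * s (\<not> b) l)"
    and zero: "\<And>b. A b 0 0 = 1" "\<And>b. s b 0 = 1"
    and diag: "\<And>j. 0 < j \<Longrightarrow> A True j j * A False j j < 1"
  shows "(\<lambda>N. X b N j) \<longlonglongrightarrow> s b j"
proof -
  have X_nonneg: "0 \<le> X b N j" for b N j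
    by (induction N arbitrary: b j) (auto simp: init rec intro!: sum_nonneg mult_nonneg_nonneg nonneg)
  have X_le: "X b N j \<le> s b j" for b N j
  proof (induction N arbitrary: b j)
    case 0
    then show ?case using zero nonneg by (auto simp: init)
  next
    case (Suc N)
    then show ?case
      by (subst fix_s) (auto simp: rec intro!: sum_mono mult_left_mono nonneg)
  qed
  have X_Suc: "X b N j \<le> X b (Suc N) j" for b N j
  proof (induction N arbitrary: b j)
    case 0
    then show ?case
      using X_nonneg[of b "Suc 0" j] by (cases "j = 0") (auto simp: init rec zero)
  next
    case (Suc N)
    show ?case
      unfolding rec[of b "Suc N"] rec[of b N] by (intro sum_mono mult_left_mono Suc nonneg)
  qed
  define L where "L = (\<lambda>b j. lim (\<lambda>N. X b N j))"
  have lim: "(\<lambda>N. X b N j) \<longlonglongrightarrow> L b j" for b j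
  proof -
    have "incseq (\<lambda>N. X b N j)"
      using X_Suc by (rule incseq_SucI)
    then obtain l where "(\<lambda>N. X b N j) \<longlonglongrightarrow> l"
      by (rule incseq_convergent[where B = "s b j"]) (simp_all add: X_le)
    then show ?thesis
      unfolding L_def by (simp add: limI)
  qed
  have L_rec: "L b j = (\<Sum>l\<le>j. A b j l * L (\<not> b) l)" for b j
  proof (rule LIMSEQ_unique)
    show "(\<lambda>N. X b (Suc N) j) \<longlonglongrightarrow> L b j"
      using lim by (rule LIMSEQ_Suc)
    show "(\<lambda>N. X b (Suc N) j) \<longlonglongrightarrow> (\<Sum>l\<le>j. A b j l * L (\<not> b) l)"
      unfolding rec by (intro tendsto_intros lim)
  qed
  have "L b j = s b j" for b
  proof (induction j arbitrary: b rule: less_induct)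
    case (less j)
    show ?case
    proof (cases "j = 0")
      case True
      \<comment> \<open>At \<open>j = 0\<close> the diagonal entries are 1 and give no contraction,
        so the value is computed directly.\<close>
      have "X b N 0 = 1" for b N
        by (induction N arbitrary: b) (auto simp: init rec zero)
      then show ?thesis
        using lim[of b 0] zero True by (simp add: LIMSEQ_const_iff)
    next
      case False
      have d: "s b j - L b j = A b j j * (s (\<not> b) j - L (\<not> b) j)" for b
      proof -
        have "s b j - L b j = (\<Sum>l\<le>j. A b j l * (s (\<not> b) l - L (\<not> b) l))"
          using fix_s[of b j] L_rec[of b j] by (simp add: sum_subtractf right_diff_distrib)
        also have "\<dots> = (\<Sum>l\<in>{j}. A b j l * (s (\<not> b) l - L (\<not> b) l))"
          using less by (intro sum.mono_neutral_right) auto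
        finally show ?thesis by simp
      qed
      have "s b j - L b j = A True j j * A False j j * (s b j - L b j)" for b
      proof -
        have "s b j - L b j = A b j j * (A (\<not> b) j j * (s b j - L b j))"
          using d[of b] d[of "\<not> b"] by simp
        then show ?thesis by (cases b) (simp_all add: mult_ac)
      qed
      then show ?thesis
        using diag[of j] False by (smt (verit) mult_cancel_right1 neq0_conv)
    qed
  qed
  with lim show ?thesis by metis
qed

text \<open>Every finite subset of \<open>A\<close> lies in some \<open>F n\<close>, so
  \<open>s\<close> bounds all finite sums. This gives summability and one inequality; the other
  holds because each \<open>sum f (F n)\<close> is at most the infinite sum.\<close>

lemma has_sum_exhaustion:
  fixes f :: "'a \<Rightarrow> real"
  assumes "\<And>x. x \<in> A \<Longrightarrow> 0 \<le> f x" and "\<And>n. finite (F n)" and "incseq F" and "(\<Union>n. F n) = A"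
    and lim: "(\<lambda>n. sum f (F n)) \<longlonglongrightarrow> s"
  shows "(f has_sum s) A"
proof -
  have mono: "incseq (\<lambda>n. sum f (F n))"
    using assms by (intro incseq_SucI sum_mono2) (auto dest: incseq_SucD)
  have le: "sum f (F n) \<le> s" for n
    using mono lim by (rule incseq_le)
  have fin: "sum f G \<le> s" if G: "finite G" "G \<subseteq> A" for G
  proof -
    have "\<exists>n. G \<subseteq> F n"
      using G
    proof (induction G rule: finite_induct)
      case (insert x G)
      then obtain n m where "G \<subseteq> F n" "x \<in> F m"
        using assms(4) by auto
      then have "insert x G \<subseteq> F (max n m)"
        using incseqD[OF \<open>incseq F\<close>, of n "max n m"] incseqD[OF \<open>incseq F\<close>, of m "max n m"] by auto
      then show ?case ..
    qed auto
    then obtain n where "G \<subseteq> F n" ..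
    then have "sum f G \<le> sum f (F n)"
      using assms by (intro sum_mono2) auto
    with le show ?thesis by (meson order_trans)
  qed
  have "f summable_on A"
    using assms(1) fin by (intro nonneg_bdd_above_summable_on bdd_aboveI[of _ s]) auto
  then have hs: "(f has_sum infsum f A) A" by simp
  moreover have "infsum f A = s"
  proof (rule antisym)
    show "infsum f A \<le> s"
      using \<open>f summable_on A\<close> fin by (rule infsum_le_finite_sums)
    show "s \<le> infsum f A"
    proof (rule LIMSEQ_le_const2[OF lim])
      show "\<exists>N. \<forall>n\<ge>N. sum f (F n) \<le> infsum f A"
        using \<open>f summable_on A\<close> assms by (intro exI allI impI finite_sum_le_infsum) auto
    qed
  qed
  ultimately show ?thesis by simp
qed

section \<open>Removing the first column\<close>

lemma column_length_eq_size: "column_length \<mu> i = size (filter_mset (\<lambda>j. i \<le> j) \<mu>)"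
  unfolding column_length_def size_multiset_overloaded_eq by (rule sum.cong) auto

text \<open>The bound \<open>N\<close> on the parts bounds the number of columns, so it counts the
  steps of the recursion.\<close>

definition bounded_partitions :: "nat \<Rightarrow> nat \<Rightarrow> nat multiset set" where
  "bounded_partitions N j = {\<mu>. set_mset \<mu> \<subseteq> {1..N} \<and> size \<mu> = j}"

text \<open>Every part grows by one, and new parts 1 fill the first column up to length
  \<open>j\<close>. The truncated subtraction has the intended meaning when
  \<open>size \<nu> \<le> j\<close>.\<close>

definition add_column :: "nat \<Rightarrow> nat multiset \<Rightarrow> nat multiset" where
  "add_column j \<nu> = image_mset Suc \<nu> + replicate_mset (j - size \<nu>) 1"

lemma bounded_partitions_0: "bounded_partitions 0 j = (if j = 0 then {{#}} else {})"
  by (auto simp: bounded_partitions_def)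

lemma count_add_column:
  "count (add_column j \<nu>) (Suc i) = (if i = 0 then j - size \<nu> else 0) + count \<nu> i"
proof -
  have "count (image_mset Suc \<nu>) (Suc i) = count \<nu> i"
    by (induction \<nu>) auto
  then show ?thesis
    by (simp add: add_column_def)
qed

lemma column_length_add_column:
  assumes "1 \<le> i"
  shows "column_length (add_column j \<nu>) (Suc i) = column_length \<nu> i"
  using assms by (simp add: column_length_eq_size add_column_def filter_mset_image_mset)

lemma column_length_1: "0 \<notin># \<mu> \<Longrightarrow> column_length \<mu> 1 = size \<mu>"
  unfolding column_length_eq_size
  by (metis One_nat_def Suc_leI bot_nat_0.not_eq_extremum filter_mset_True filter_mset_cong)

lemma sum_mset_Suc: "sum_mset (image_mset Suc \<nu>) = sum_mset \<nu> + size \<nu>"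
  by (induction \<nu>) auto

text \<open>The preimage of \<open>\<mu>\<close> is found by dropping the parts equal to 1 and
  lowering all others by one. The number of dropped parts is then
  \<open>j - size \<nu>\<close>.\<close>

lemma bounded_partitions_Suc:
  "bounded_partitions (Suc N) j = add_column j ` (\<Union>l\<le>j. bounded_partitions N l)"
proof (intro equalityI subsetI)
  fix \<mu> assume \<mu>: "\<mu> \<in> bounded_partitions (Suc N) j"
  define \<mu>' where "\<mu>' = filter_mset (\<lambda>i. 2 \<le> i) \<mu>"
  define \<nu> where "\<nu> = image_mset (\<lambda>i. i - 1) \<mu>'"
  have part: "\<mu> = \<mu>' + filter_mset (\<lambda>i. \<not> 2 \<le> i) \<mu>"
    by (simp add: \<mu>'_def)
  have "set_mset (filter_mset (\<lambda>i. \<not> 2 \<le> i) \<mu>) \<subseteq> {1}"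
    using \<mu> by (auto simp: bounded_partitions_def)
  from set_mset_subset_singletonD[OF this]
  obtain n where n: "filter_mset (\<lambda>i. \<not> 2 \<le> i) \<mu> = replicate_mset n 1" by blast
  have "image_mset Suc \<nu> = image_mset id \<mu>'"
    unfolding \<nu>_def multiset.map_comp by (rule image_mset_cong) (auto simp: \<mu>'_def)
  then have S: "image_mset Suc \<nu> = \<mu>'" by simp
  have size: "size \<mu> = size \<nu> + n"
    by (subst part) (simp add: n \<nu>_def)
  then have j: "j - size \<nu> = n"
    using \<mu> by (auto simp: bounded_partitions_def)
  have "\<mu> = add_column j \<nu>"
    unfolding add_column_def S j by (rule part[unfolded n])
  moreover have "\<nu> \<in> bounded_partitions N (size \<nu>)" "size \<nu> \<le> j"
    using \<mu> size by (force simp: \<nu>_def \<mu>'_def bounded_partitions_def)+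
  ultimately show "\<mu> \<in> add_column j ` (\<Union>l\<le>j. bounded_partitions N l)" by blast
qed (auto simp: bounded_partitions_def add_column_def subset_iff split: if_splits)

text \<open>As 0 is not a part of \<open>\<nu>\<close>, the multiplicity of 1 in
  \<open>add_column j \<nu>\<close> is \<open>j - size \<nu>\<close>. It determines the size of
  \<open>\<nu>\<close>, and then lowering the remaining parts recovers \<open>\<nu>\<close>
  itself.\<close>

lemma inj_on_add_column: "inj_on (add_column j) (\<Union>l\<le>j. bounded_partitions N l)"
proof (rule inj_onI)
  fix \<nu> \<nu>'
  assume \<nu>: "\<nu> \<in> (\<Union>l\<le>j. bounded_partitions N l)" "\<nu>' \<in> (\<Union>l\<le>j. bounded_partitions N l)"
    and eq: "add_column j \<nu> = add_column j \<nu>'"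
  have "count \<nu> 0 = 0" "count \<nu>' 0 = 0" "size \<nu> \<le> j" "size \<nu>' \<le> j"
    using \<nu> by (auto simp: bounded_partitions_def count_eq_zero_iff)
  then have "size \<nu> = size \<nu>'"
    using arg_cong[OF eq, of "\<lambda>\<mu>. count \<mu> (Suc 0)"] by (simp add: count_add_column)
  with eq have "image_mset Suc \<nu> = image_mset Suc \<nu>'"
    by (simp add: add_column_def)
  then have "image_mset (\<lambda>i. i - 1) (image_mset Suc \<nu>) = image_mset (\<lambda>i. i - 1) (image_mset Suc \<nu>')"
    by simp
  then show "\<nu> = \<nu>'"
    by (simp add: multiset.map_comp o_def)
qed

lemma finite_bounded_partitions: "finite (bounded_partitions N j)"
  by (induction N arbitrary: j) (auto simp: bounded_partitions_0 bounded_partitions_Suc)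

lemma sum_bounded_partitions_Suc:
  "sum g (bounded_partitions (Suc N) j)
     = (\<Sum>l\<le>j. \<Sum>\<nu>\<in>bounded_partitions N l. g (add_column j \<nu>))"
proof -
  have "sum g (bounded_partitions (Suc N) j)
      = (\<Sum>\<nu>\<in>(\<Union>l\<le>j. bounded_partitions N l). g (add_column j \<nu>))"
    by (simp add: bounded_partitions_Suc sum.reindex[OF inj_on_add_column])
  also have "\<dots> = (\<Sum>l\<le>j. \<Sum>\<nu>\<in>bounded_partitions N l. g (add_column j \<nu>))"
    by (rule sum.UNION_disjoint) (auto simp: finite_bounded_partitions, auto simp: bounded_partitions_def)
  finally show ?thesis .
qed

text \<open>The measures without their constant prefactor, with \<open>f i m\<close> in place of the
  reciprocals of the \<open>a_factor\<close> and \<open>c_factor\<close> values. The range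
  \<open>N\<close> is a separate argument because the recursion removes one column at a time, while
  \<open>sum_mset \<mu>\<close> drops by the whole column.\<close>

definition weight :: "real \<Rightarrow> real \<Rightarrow> (nat \<Rightarrow> nat \<Rightarrow> real) \<Rightarrow> nat \<Rightarrow> nat multiset \<Rightarrow> real" where
  "weight q u f N \<mu> = u ^ sum_mset \<mu> *
     q powr (((\<Sum>i=1..N. (real (count \<mu> i))\<^sup>2) - (\<Sum>i=1..N. (real (column_length \<mu> i))\<^sup>2)) / 2) *
     (\<Prod>i=1..N. f i (count \<mu> i))"

lemma weight_mono_neutral:
  assumes "set_mset \<mu> \<subseteq> {1..N}" "N \<le> N'" "\<And>i. f i 0 = 1"
  shows "weight q u f N' \<mu> = weight q u f N \<mu>"
proof -
  have *: "count \<mu> i = 0" "column_length \<mu> i = 0" if "i \<in> {1..N'} - {1..N}" for i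
    using that assms(1) by (force simp: column_length_eq_size count_eq_zero_iff filter_mset_eq_conv)+
  have "(\<Sum>i=1..N'. (real (count \<mu> i))\<^sup>2) = (\<Sum>i=1..N. (real (count \<mu> i))\<^sup>2)"
    "(\<Sum>i=1..N'. (real (column_length \<mu> i))\<^sup>2) = (\<Sum>i=1..N. (real (column_length \<mu> i))\<^sup>2)"
    using * assms(2) by (auto intro!: sum.mono_neutral_right)
  moreover have "(\<Prod>i=1..N'. f i (count \<mu> i)) = (\<Prod>i=1..N. f i (count \<mu> i))"
    using * assms by (intro prod.mono_neutral_right) auto
  ultimately show ?thesis by (simp add: weight_def)
qed

lemma set_mset_subset_sum_mset:
  assumes "0 \<notin># (\<mu> :: nat multiset)"
  shows "set_mset \<mu> \<subseteq> {1..sum_mset \<mu>}"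
proof
  fix i assume "i \<in># \<mu>"
  then show "i \<in> {1..sum_mset \<mu>}"
    using assms by (auto simp: Suc_le_eq intro!: Nat.gr0I dest!: multi_member_split)
qed

text \<open>Links the range used in the measures to the range used in the recursion. Either bound
  may be the larger one, so both are compared with their maximum.\<close>

lemma weight_sum_mset:
  assumes "set_mset \<mu> \<subseteq> {1..N}" "\<And>i. f i 0 = 1"
  shows "weight q u f (sum_mset \<mu>) \<mu> = weight q u f N \<mu>"
proof -
  have "0 \<notin># \<mu>" using assms by auto
  then show ?thesis
    using weight_mono_neutral[of \<mu> _ "max N (sum_mset \<mu>)" f q u] assms set_mset_subset_sum_mset[of \<mu>]
    by (metis max.cobounded1 max.cobounded2)
qed

text \<open>The new column has length \<open>j\<close> and creates \<open>j - l\<close> parts equal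
  to 1, which accounts for the two squares and \<open>f 1 (j - l)\<close>. All other multiplicities
  and column lengths move up by one index, hence the shifted \<open>f\<close>.\<close>

lemma weight_add_column:
  assumes "\<nu> \<in> bounded_partitions N l" "l \<le> j" "0 < q"
  shows "weight q u f (Suc N) (add_column j \<nu>) =
    u ^ j * q powr (((real j - real l)\<^sup>2 - (real j)\<^sup>2) / 2) * f 1 (j - l) * weight q u (\<lambda>i. f (Suc i)) N \<nu>"
proof -
  let ?\<mu> = "add_column j \<nu>"
  have \<nu>: "0 \<notin># \<nu>" "size \<nu> = l"
    using assms by (auto simp: bounded_partitions_def)
  have \<mu>: "size ?\<mu> = j" "0 \<notin># ?\<mu>" "sum_mset ?\<mu> = j + sum_mset \<nu>"
    using \<nu> assms by (auto simp: add_column_def sum_mset_Suc)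
  have count: "count ?\<mu> 1 = j - l" "i \<in> {1..N} \<Longrightarrow> count ?\<mu> (Suc i) = count \<nu> i" for i
    using \<nu> count_add_column[of j \<nu>] by (auto simp: count_eq_zero_iff)
  have col: "column_length ?\<mu> 1 = j" "i \<in> {1..N} \<Longrightarrow> column_length ?\<mu> (Suc i) = column_length \<nu> i" for i
    using \<mu> by (auto simp: column_length_1 column_length_add_column simp del: One_nat_def)
  have sum: "(\<Sum>i=1..Suc N. g i) = g 1 + (\<Sum>i=1..N. g (Suc i))" for g :: "nat \<Rightarrow> real"
    by (induction N) auto
  have prod: "(\<Prod>i=1..Suc N. g i) = g 1 * (\<Prod>i=1..N. g (Suc i))" for g :: "nat \<Rightarrow> real"
    by (induction N) auto
  have e: "(((real j - real l)\<^sup>2 + c) - ((real j)\<^sup>2 + d)) / 2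
      = ((real j - real l)\<^sup>2 - (real j)\<^sup>2) / 2 + (c - d) / 2" for c d
    by (simp add: field_simps)
  show ?thesis
    unfolding weight_def sum prod using \<mu> count col assms
    by (simp add: power_add e powr_add of_nat_diff del: One_nat_def)
qed

text \<open>The multiplicities add up to the number of parts, so the local powers of
  \<open>q\<close> collect into a single one.\<close>

lemma weight_scale:
  assumes "\<mu> \<in> bounded_partitions N j" "0 < q"
  shows "weight q u (\<lambda>i m. q powr (c * real m) * f i m) N \<mu> = q powr (c * real j) * weight q u f N \<mu>"
proof -
  have "size \<mu> = (\<Sum>i=1..N. count \<mu> i)"
    unfolding size_multiset_overloaded_eq using assms
    by (intro sum.mono_neutral_left) (auto simp: bounded_partitions_def count_eq_zero_iff)
  then have "j = (\<Sum>i=1..N. count \<mu> i)"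
    using assms by (simp add: bounded_partitions_def)
  then have "c * real j = (\<Sum>i=1..N. c * real (count \<mu> i))"
    by (simp add: sum_distrib_left)
  then have "(\<Prod>i=1..N. q powr (c * real (count \<mu> i))) = q powr (c * real j)"
    using assms by (simp add: powr_sum)
  then show ?thesis
    by (simp add: weight_def prod.distrib)
qed

text \<open>
  The flag selects the symplectic (\<open>True\<close>) or the orthogonal (\<open>False\<close>) measure. The parity condition
  is built into the local factors.
\<close>

definition local_factor :: "real \<Rightarrow> bool \<Rightarrow> nat \<Rightarrow> nat \<Rightarrow> real" where
  "local_factor q sp i m =
     (if odd m \<and> (odd i \<longleftrightarrow> sp) then 0 else 1 / (if sp then a_factor q i m else c_factor q i m))"

lemma local_factor_0 [simp]: "0 < q \<Longrightarrow> local_factor q sp i 0 = 1"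
  by (simp add: local_factor_def a_factor_def c_factor_def)

lemma local_factor_nonneg:
  assumes "1 < q"
  shows "0 \<le> local_factor q sp i m"
proof -
  have "0 \<le> (\<Prod>l=1..n. (q ^ (2 * l) - 1))" for n
    using assms by (intro prod_nonneg) auto
  then show ?thesis
    by (auto simp: local_factor_def a_factor_def c_factor_def)
qed

text \<open>Raising the index flips its parity, so the two factors to compare have the same product
  of \<open>q ^ (2 * l) - 1\<close>. In each admissible case the exponents of \<open>q\<close>
  differ by \<open>m / 2\<close>; the excluded cases also correspond, with both sides 0.\<close>

lemma local_factor_Suc:
  assumes "0 < q"
  shows "local_factor q sp (Suc i) m
    = q powr ((if sp then - 1 / 2 else 1 / 2) * real m) * local_factor q (\<not> sp) i m"
proof -
  have P: "1 / (q powr a * r) = q powr d * (1 / (q powr b * r))" if "b = a + d" for a b d r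
    using assms that by (simp add: powr_add)
  show ?thesis
    unfolding local_factor_def a_factor_def c_factor_def
    by (cases "even i"; cases "even m"; cases sp;
        simp only: even_Suc simp_thms if_True if_False; (rule P)?; simp add: power2_eq_square field_simps)
qed

text \<open>A part violating the parity condition lies in the range of the product and has local
  factor 0, which reproduces the \<open>else\<close> branch. Otherwise all local factors are
  reciprocals, also at non-parts, whose multiplicity is 0.\<close>

lemma M_eq_weight:
  assumes "0 \<notin># \<mu>" "0 < q"
  shows "M_Sp q u \<mu> = euler_product q u * weight q u (local_factor q True) (sum_mset \<mu>) \<mu>"
    and "M_O q u \<mu> = 1 / (1 + u) * euler_product q u * weight q u (local_factor q False) (sum_mset \<mu>) \<mu>"
proof -
  let ?N = "sum_mset \<mu>"
  have in_N: "i \<in> {1..?N}" if "i \<in># \<mu>" for i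
    using that set_mset_subset_sum_mset[OF assms(1)] by blast
  have *: "u ^ ?N / (q powr q_exponent \<mu> * (\<Prod>i=1..?N. if sp then a_factor q i (count \<mu> i) else c_factor q i (count \<mu> i)))
      = weight q u (local_factor q sp) ?N \<mu>"
    if "\<forall>i\<in>#\<mu>. (odd i \<longleftrightarrow> sp) \<longrightarrow> even (count \<mu> i)" for sp
  proof -
    have "local_factor q sp i (count \<mu> i) = 1 / (if sp then a_factor q i (count \<mu> i) else c_factor q i (count \<mu> i))" for i
    proof (cases "i \<in># \<mu>")
      case False
      then have "count \<mu> i = 0" by (simp add: count_eq_zero_iff)
      then show ?thesis using assms by (simp add: a_factor_def c_factor_def)
    qed (use that in \<open>auto simp: local_factor_def\<close>)
    then have "(\<Prod>i=1..?N. local_factor q sp i (count \<mu> i))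
        = 1 / (\<Prod>i=1..?N. if sp then a_factor q i (count \<mu> i) else c_factor q i (count \<mu> i))"
      by (simp only: prod_dividef prod.neutral_const)
    moreover have "((\<Sum>i=1..?N. (real (count \<mu> i))\<^sup>2) - (\<Sum>i=1..?N. (real (column_length \<mu> i))\<^sup>2)) / 2 = - q_exponent \<mu>"
      by (simp add: q_exponent_def field_simps)
    moreover have "a / (q powr e * P) = a * q powr (- e) * (1 / P)" for a e P
      by (simp add: powr_minus divide_inverse)
    ultimately show ?thesis
      unfolding weight_def by (simp only:)
  qed
  have zero: "weight q u (local_factor q sp) ?N \<mu> = 0"
    if "\<not> (\<forall>i\<in>#\<mu>. (odd i \<longleftrightarrow> sp) \<longrightarrow> even (count \<mu> i))" for sp
  proof -
    have "\<exists>i\<in>{1..?N}. local_factor q sp i (count \<mu> i) = 0"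
      using that in_N by (auto simp: local_factor_def)
    then show ?thesis by (simp add: weight_def prod_zero)
  qed
  show "M_Sp q u \<mu> = euler_product q u * weight q u (local_factor q True) ?N \<mu>"
    using *[of True] zero[of True] by (auto simp: M_Sp_def)
  show "M_O q u \<mu> = 1 / (1 + u) * euler_product q u * weight q u (local_factor q False) ?N \<mu>"
    using *[of False] zero[of False] by (auto simp: M_O_def)
qed

section \<open>Recursion for the sums over partitions with bounded parts\<close>

definition truncated_sum :: "real \<Rightarrow> real \<Rightarrow> bool \<Rightarrow> nat \<Rightarrow> nat \<Rightarrow> real" where
  "truncated_sum q u sp N j = (\<Sum>\<mu>\<in>bounded_partitions N j. weight q u (local_factor q sp) N \<mu>)"

text \<open>Contribution of a first column of length \<open>j\<close> followed by a second of length
  \<open>l\<close>. The summand with \<open>real l / 2\<close> in the exponent comes from the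
  exchange of the two kinds of local factors.\<close>

definition column_transfer :: "real \<Rightarrow> real \<Rightarrow> bool \<Rightarrow> nat \<Rightarrow> nat \<Rightarrow> real" where
  "column_transfer q u sp j l =
     u ^ j * q powr (((real j - real l)\<^sup>2 - (real j)\<^sup>2) / 2 + (if sp then - 1 / 2 else 1 / 2) * real l)
       * local_factor q sp 1 (j - l)"

lemma truncated_sum_0: "0 < q \<Longrightarrow> truncated_sum q u sp 0 j = (if j = 0 then 1 else 0)"
  by (simp add: truncated_sum_def bounded_partitions_0 weight_def)

lemma truncated_sum_Suc:
  assumes "0 < q"
  shows "truncated_sum q u sp (Suc N) j
     = (\<Sum>l\<le>j. column_transfer q u sp j l * truncated_sum q u (\<not> sp) N l)"
proof -
  define c :: real where "c = (if sp then - 1 / 2 else 1 / 2)"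
  have lf: "(\<lambda>i. local_factor q sp (Suc i)) = (\<lambda>i m. q powr (c * real m) * local_factor q (\<not> sp) i m)"
    by (intro ext) (simp only: local_factor_Suc[OF assms] c_def)
  have "weight q u (local_factor q sp) (Suc N) (add_column j \<nu>)
      = column_transfer q u sp j l * weight q u (local_factor q (\<not> sp)) N \<nu>"
    if "l \<le> j" "\<nu> \<in> bounded_partitions N l" for l \<nu>
    using that assms
    by (simp add: weight_add_column weight_scale lf column_transfer_def powr_add
        flip: c_def del: One_nat_def)
  then show ?thesis
    unfolding truncated_sum_def sum_bounded_partitions_Suc sum_distrib_left by simp
qed

section \<open>Closed forms\<close>

text \<open>The sums over the second column length are split by parity because
  \<open>column_transfer\<close> and the closed form depend on it.\<close>

lemma sum_atMost_even: "(\<Sum>l\<le>2 * k. f l) = (\<Sum>h\<le>k. f (2 * h)) + (\<Sum>h<k. f (2 * h + 1))"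
  for f :: "nat \<Rightarrow> real"
  by (induction k) simp_all

lemma sum_atMost_odd: "(\<Sum>l\<le>2 * k + 1. f l) = (\<Sum>h\<le>k. f (2 * h) + f (2 * h + 1))"
  for f :: "nat \<Rightarrow> real"
  by (induction k) simp_all

text \<open>The claimed probability without its prefactor, in one formula for both parities of
  \<open>j\<close>. In the symplectic case the exponent of \<open>u\<close> is \<open>j\<close>
  rounded up to an even number.\<close>

definition closed_form :: "real \<Rightarrow> real \<Rightarrow> bool \<Rightarrow> nat \<Rightarrow> real" where
  "closed_form q u sp j =
     u ^ (if sp then 2 * ((j + 1) div 2) else j) *
     q powr (- ((real j)\<^sup>2 + (if sp then 1 else - 1) * real j) / 2) /
     (q_poch (1 / q\<^sup>2) (u\<^sup>2 / q) ((j + 1) div 2) * q_poch (1 / q\<^sup>2) (1 / q\<^sup>2) (j div 2))"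

section \<open>Local factors and transfer coefficients in the parameters \<open>p\<close> and
  \<open>x\<close>\<close>

context
  fixes q u p x :: real
  assumes q: "1 < q" and u: "0 < u" "u \<le> 1" and p: "p = 1 / q\<^sup>2" and x: "x = u\<^sup>2 / q"
begin

lemma parameter_bounds: "0 < p" "p < 1" "0 \<le> x" "x < 1"
proof -
  have "u\<^sup>2 \<le> 1" using u by (simp add: power_le_one)
  with q u show "0 < p" "p < 1" "0 \<le> x" "x < 1"
    unfolding p x by (auto simp: divide_simps power_one_over)
qed

lemma q_poch_parameters_pos: "0 < q_poch p x n" "0 < q_poch p p n"
  using parameter_bounds by (auto intro!: q_poch_pos)

text \<open>Taking \<open>q ^ (2 * l)\<close> out of each factor leaves \<open>1 - p ^ l\<close>,
  and the exponents \<open>2 * l\<close> add up to \<open>n * n + n\<close>.\<close>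

lemma prod_eq_q_poch: "(\<Prod>l=1..n. q ^ (2 * l) - 1) = q powr ((real n)\<^sup>2 + real n) * q_poch p p n"
proof (induction n)
  case (Suc n)
  have "q ^ (2 * Suc n) - 1 = q powr (2 * real n + 2) * (1 - p * p ^ n)"
  proof -
    have "q powr (2 * real n + 2) = q ^ (2 * Suc n)"
      using q powr_realpow[of q "2 * Suc n"] by (simp add: add.commute)
    moreover have "p * p ^ n = 1 / q ^ (2 * Suc n)"
      unfolding p power_one_over power_mult power_Suc by simp
    then have "q ^ (2 * Suc n) * (p * p ^ n) = 1"
      using q by simp
    ultimately show ?thesis by (simp add: right_diff_distrib)
  qed
  moreover have "q powr ((real (Suc n))\<^sup>2 + real (Suc n))
      = q powr ((real n)\<^sup>2 + real n) * q powr (2 * real n + 2)"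
    by (simp add: powr_add[symmetric] power2_eq_square algebra_simps)
  ultimately show ?case
    using Suc by (simp add: q_poch_Suc)
qed (use q in simp)

text \<open>The exponents from the local factor and from \<open>prod_eq_q_poch\<close> combine to
  the same polynomial in \<open>m\<close> for both parities of \<open>m\<close>.\<close>

lemma local_factor_1:
  "local_factor q sp 1 m =
     (if sp \<and> odd m then 0
      else q powr (- ((real m)\<^sup>2 + (if sp then 1 else - 1) * real m) / 2) / q_poch p p (m div 2))"
proof -
  have P: "1 / (q powr a * (q powr b * r)) = q powr c / r" if "c = - (a + b)" for a b c r
    unfolding that powr_minus_divide powr_add by simp
  obtain n where "m = 2 * n \<or> m = 2 * n + 1"
    by (metis oddE evenE)
  then show ?thesis
  proof
    assume m: "m = 2 * n"
    show ?thesis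
      unfolding local_factor_def a_factor_def c_factor_def m
      by (cases sp; simp only: nonzero_mult_div_cancel_left; simp only: prod_eq_q_poch)
         (simp_all, (rule P, simp add: power2_eq_square field_simps)+)
  next
    assume m: "m = 2 * n + 1"
    show ?thesis
      unfolding local_factor_def a_factor_def c_factor_def m
      by (cases sp) (simp_all add: prod_eq_q_poch[unfolded One_nat_def], (rule P, simp add: power2_eq_square field_simps)+)
  qed
qed

text \<open>The terms in \<open>l\<close> cancel in the exponent of \<open>q\<close>. Only the
  parity of \<open>j - l\<close> and the factor \<open>q_poch p p ((j - l) div 2)\<close> still
  depend on \<open>l\<close>, which gives the recursion the shape of a \<open>q\<close>-Vandermonde
  sum.\<close>

lemma column_transfer_eq:
  assumes "l \<le> j"
  shows "column_transfer q u sp j l =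
     (if sp \<and> odd (j - l) then 0
      else u ^ j * q powr (- ((real j)\<^sup>2 + (if sp then 1 else - 1) * real j) / 2) / q_poch p p ((j - l) div 2))"
proof -
  have "((real j - real l)\<^sup>2 - (real j)\<^sup>2) / 2 + (if sp then - 1 / 2 else 1 / 2) * real l +
      - ((real j - real l)\<^sup>2 + (if sp then 1 else - 1) * (real j - real l)) / 2
      = - ((real j)\<^sup>2 + (if sp then 1 else - 1) * real j) / 2"
    by (simp add: power2_eq_square field_simps)
  then have e: "q powr (((real j - real l)\<^sup>2 - (real j)\<^sup>2) / 2 + (if sp then - 1 / 2 else 1 / 2) * real l) *
      q powr (- ((real j - real l)\<^sup>2 + (if sp then 1 else - 1) * (real j - real l)) / 2)
      = q powr (- ((real j)\<^sup>2 + (if sp then 1 else - 1) * real j) / 2)"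
    by (simp only: powr_add[symmetric])
  show ?thesis
  proof (cases "sp \<and> odd (j - l)")
    case True
    then show ?thesis
      by (simp add: column_transfer_def local_factor_1 del: One_nat_def)
  next
    case False
    show ?thesis
      unfolding column_transfer_def local_factor_1 if_not_P[OF False] of_nat_diff[OF assms]
      by (simp only: mult.assoc times_divide_eq_right e)
  qed
qed

section \<open>The closed form as a fixed point of the recursion\<close>

lemma powr_eq_parameters:
  assumes "c = - (real a + 2 * real b)"
  shows "u ^ (2 * a) * q powr c = x ^ a * p ^ b"
proof -
  have "c = - real (a + 2 * b)"
    using assms by simp
  then have "q powr c = 1 / q ^ (a + 2 * b)"
    using q by (simp only: powr_minus_divide powr_realpow)
  then have "q powr c = 1 / (q ^ a * (q\<^sup>2) ^ b)"
    by (simp only: power_add power_mult)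
  then show ?thesis
    by (simp add: x p power_divide power_mult)
qed

lemma closed_form_eq:
  "closed_form q u True (2 * h) = x ^ h * p ^ (h * h) / (q_poch p x h * q_poch p p h)"
  "closed_form q u True (2 * h + 1) = x ^ Suc h * p ^ (Suc h * h) / (q_poch p x (Suc h) * q_poch p p h)"
  "closed_form q u False (2 * h) = x ^ h * p ^ (h * (h - 1)) / (q_poch p x h * q_poch p p h)"
  "closed_form q u False (2 * h + 1) = u * (x ^ h * p ^ (h * h)) / (q_poch p x (Suc h) * q_poch p p h)"
proof -
  \<comment> \<open>The truncated difference does no harm at \<open>h = 0\<close>, where the product
    is 0 anyway.\<close>
  have h: "real (h * (h - 1)) = real h * real h - real h"
    by (cases h) (auto simp: algebra_simps)
  show "closed_form q u True (2 * h) = x ^ h * p ^ (h * h) / (q_poch p x h * q_poch p p h)"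
    unfolding closed_form_def p[symmetric] x[symmetric]
    using powr_eq_parameters[of "- ((real (2 * h))\<^sup>2 + 1 * real (2 * h)) / 2" h "h * h"]
    by (simp add: power2_eq_square field_simps)
  show "closed_form q u True (2 * h + 1) = x ^ Suc h * p ^ (Suc h * h) / (q_poch p x (Suc h) * q_poch p p h)"
    unfolding closed_form_def p[symmetric] x[symmetric]
    using powr_eq_parameters[of "- ((real (2 * h + 1))\<^sup>2 + 1 * real (2 * h + 1)) / 2" "Suc h" "Suc h * h"]
    by (simp add: power2_eq_square field_simps)
  show "closed_form q u False (2 * h) = x ^ h * p ^ (h * (h - 1)) / (q_poch p x h * q_poch p p h)"
    unfolding closed_form_def p[symmetric] x[symmetric]
    using powr_eq_parameters[of "- ((real (2 * h))\<^sup>2 + - 1 * real (2 * h)) / 2" h "h * (h - 1)"] h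
    by (simp add: power2_eq_square field_simps del: of_nat_mult)
  show "closed_form q u False (2 * h + 1) = u * (x ^ h * p ^ (h * h)) / (q_poch p x (Suc h) * q_poch p p h)"
    unfolding closed_form_def p[symmetric] x[symmetric]
    using powr_eq_parameters[of "- ((real (2 * h + 1))\<^sup>2 + - 1 * real (2 * h + 1)) / 2" h "h * h"]
    by (simp add: power2_eq_square field_simps)
qed

text \<open>In the symplectic case only \<open>l\<close> of the parity of \<open>j\<close>
  contribute, and each term is a Vandermonde summand. In the orthogonal case two neighbouring values
  of \<open>l\<close> share one summand: \<open>2 * h - 1\<close> and \<open>2 * h\<close> for even
  \<open>j\<close>, \<open>2 * h\<close> and \<open>2 * h + 1\<close> for odd
  \<open>j\<close>.\<close>

lemma closed_form_fixed_point:
  "closed_form q u sp j = (\<Sum>l\<le>j. column_transfer q u sp j l * closed_form q u (\<not> sp) l)"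
proof -
  define C where "C = u ^ j * q powr (- ((real j)\<^sup>2 + (if sp then 1 else - 1) * real j) / 2)"
  have transfer: "column_transfer q u sp j l = (if sp \<and> odd (j - l) then 0 else C / q_poch p p ((j - l) div 2))"
    if "l \<le> j" for l
    using that by (simp add: column_transfer_eq C_def)
  \<comment> \<open>The extra \<open>u\<close> is the rounding of its exponent to an even
    number.\<close>
  have closed: "closed_form q u sp j = (if sp \<and> odd j then u else 1) * C *
      (1 / (q_poch p x ((j + 1) div 2) * q_poch p p (j div 2)))"
    unfolding closed_form_def p[symmetric] x[symmetric] C_def
    by (cases "odd j"; cases sp) (auto elim!: oddE evenE)
  have vandermonde:
    "(\<Sum>h\<le>k. c * (x ^ h * p ^ (h * (h - 1)) / (q_poch p x h * q_poch p p h * q_poch p p (k - h))))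
       = c * (1 / (q_poch p x k * q_poch p p k))"
    "(\<Sum>h\<le>k. c * (x ^ h * p ^ (h * h) / (q_poch p x (Suc h) * q_poch p p h * q_poch p p (k - h))))
       = c * (1 / (q_poch p x (Suc k) * q_poch p p k))" for c k
    by (simp_all only: sum_distrib_left[symmetric] q_vandermonde[OF parameter_bounds]
        q_vandermonde_shifted[OF parameter_bounds])
  have pk: "1 - p * p ^ h \<noteq> 0" for h
    using parameter_bounds by (metis power_Suc power_Suc_less_one right_minus_eq order_less_irrefl)
  obtain k where "j = 2 * k \<or> j = 2 * k + 1"
    by (metis oddE evenE)
  then show ?thesis
  proof
    assume j: "j = 2 * k"
    have d: "(2 * k - 2 * h) div 2 = k - h" "(2 * k - (2 * h + 1)) div 2 = k - Suc h" for h
      by auto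
    show ?thesis
    proof (cases sp)
      case True
      have "column_transfer q u sp j (2 * h) * closed_form q u (\<not> sp) (2 * h)
          = C * (x ^ h * p ^ (h * (h - 1)) / (q_poch p x h * q_poch p p h * q_poch p p (k - h)))"
        if "h \<le> k" for h
        using that True transfer[of "2 * h"] unfolding j d
        by (simp add: closed_form_eq del: One_nat_def)
      moreover have "column_transfer q u sp j (2 * h + 1) = 0" if "h < k" for h
        using that True transfer[of "2 * h + 1"] by (simp add: j)
      ultimately have "(\<Sum>l\<le>j. column_transfer q u sp j l * closed_form q u (\<not> sp) l)
          = (\<Sum>h\<le>k. C * (x ^ h * p ^ (h * (h - 1)) / (q_poch p x h * q_poch p p h * q_poch p p (k - h))))"
        unfolding j sum_atMost_even by simp
      then show ?thesis
        unfolding closed vandermonde by (simp add: j)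
    next
      case False
      \<comment> \<open>The share \<open>1 - p ^ h\<close> of the \<open>h\<close>-th summand, due
        to \<open>l = 2 * h - 1\<close>. It vanishes at \<open>h = 0\<close>, where there is no such
        \<open>l\<close>; the share \<open>p ^ h\<close> comes from
        \<open>l = 2 * h\<close>.\<close>
      define E where "E = (\<lambda>h. x ^ h * p ^ (h * (h - 1)) * (1 - p ^ h) / (q_poch p x h * q_poch p p h * q_poch p p (k - h)))"
      have E: "column_transfer q u sp j (2 * h + 1) * closed_form q u (\<not> sp) (2 * h + 1) = C * E (Suc h)"
        if "h < k" for h
      proof -
        have cancel: "a * b / (c * (d * b) * e) = a / (c * d * e)" if "b \<noteq> 0" for a b c d e :: real
          using that by (simp add: divide_simps)
        have "E (Suc h) = x ^ Suc h * p ^ (Suc h * h) * (1 - p * p ^ h) /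
            (q_poch p x (Suc h) * (q_poch p p h * (1 - p * p ^ h)) * q_poch p p (k - Suc h))"
          by (simp only: E_def q_poch_Suc[of p p] diff_Suc_1 power_Suc)
        also have "\<dots> = x ^ Suc h * p ^ (Suc h * h) / (q_poch p x (Suc h) * q_poch p p h * q_poch p p (k - Suc h))"
          by (rule cancel[OF pk])
        finally have "E (Suc h) = closed_form q u True (2 * h + 1) / q_poch p p (k - Suc h)"
          by (simp only: closed_form_eq divide_divide_eq_left)
        moreover have "column_transfer q u sp j (2 * h + 1) = C / q_poch p p (k - Suc h)"
          using that False transfer[of "2 * h + 1"] unfolding j d by simp
        ultimately show ?thesis
          using False by simp
      qed
      have "(\<Sum>h<k. E (Suc h)) = (\<Sum>h\<le>k. E h)"
        by (simp only: lessThan_Suc_atMost[symmetric] sum.lessThan_Suc_shift) (simp add: E_def)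
      then have odd: "(\<Sum>h<k. column_transfer q u sp j (2 * h + 1) * closed_form q u (\<not> sp) (2 * h + 1)) = (\<Sum>h\<le>k. C * E h)"
        using E by (simp flip: sum_distrib_left)
      have "column_transfer q u sp j (2 * h) * closed_form q u (\<not> sp) (2 * h) + C * E h
          = C * (x ^ h * p ^ (h * (h - 1)) / (q_poch p x h * q_poch p p h * q_poch p p (k - h)))"
        if "h \<le> k" for h
      proof -
        have "p ^ (h * h) = p ^ (h * (h - 1)) * p ^ h"
          by (cases h) (simp_all flip: power_add add: add.commute)
        moreover have "column_transfer q u sp j (2 * h) = C / q_poch p p (k - h)"
          using that False transfer[of "2 * h"] unfolding j d by simp
        moreover have "c / d * (s * (t * r) / (a * b)) + c * (s * t * (1 - r) / (a * b * d))
            = c * (s * t / (a * b * d))" for a b c d s t r :: real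
          by (simp add: divide_inverse algebra_simps)
        ultimately show ?thesis
          using False by (simp only: closed_form_eq E_def simp_thms)
      qed
      then have "(\<Sum>l\<le>j. column_transfer q u sp j l * closed_form q u (\<not> sp) l)
          = (\<Sum>h\<le>k. C * (x ^ h * p ^ (h * (h - 1)) / (q_poch p x h * q_poch p p h * q_poch p p (k - h))))"
        using odd unfolding j sum_atMost_even by (simp flip: sum.distrib)
      then show ?thesis
        unfolding closed vandermonde by (simp add: j)
    qed
  next
    assume j: "j = 2 * k + 1"
    have d: "(2 * k + 1 - 2 * h) div 2 = k - h" "(2 * k + 1 - (2 * h + 1)) div 2 = k - h" if "h \<le> k" for h
      using that by auto
    have "(\<Sum>l\<le>j. column_transfer q u sp j l * closed_form q u (\<not> sp) l)
          = (\<Sum>h\<le>k. (if sp then u else 1) * C * (x ^ h * p ^ (h * h) / (q_poch p x (Suc h) * q_poch p p h * q_poch p p (k - h))))"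
      unfolding j sum_atMost_odd
    proof (rule sum.cong[OF refl])
      fix h assume "h \<in> {..k}"
      then have h: "h \<le> k" "2 * h \<le> j" "2 * h + 1 \<le> j" by (auto simp: j)
      have o: "odd (j - 2 * h)" "even (j - (2 * h + 1))"
        using h(1) by (auto simp: j)
      show "column_transfer q u sp (2 * k + 1) (2 * h) * closed_form q u (\<not> sp) (2 * h) +
          column_transfer q u sp (2 * k + 1) (2 * h + 1) * closed_form q u (\<not> sp) (2 * h + 1)
        = (if sp then u else 1) * C * (x ^ h * p ^ (h * h) / (q_poch p x (Suc h) * q_poch p p h * q_poch p p (k - h)))"
      proof (cases sp)
        case True
        then have T: "column_transfer q u sp (2 * k + 1) (2 * h) = 0"
          "column_transfer q u sp (2 * k + 1) (2 * h + 1) = C / q_poch p p (k - h)"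
          using transfer[OF h(2)] transfer[OF h(3)] o unfolding j d[OF h(1)] by simp_all
        then show ?thesis
          using True by (simp only: T closed_form_eq simp_thms if_True mult_zero_left add_0) (simp add: mult_ac)
      next
        case False
        then have T: "column_transfer q u sp (2 * k + 1) (2 * h) = C / q_poch p p (k - h)"
          "column_transfer q u sp (2 * k + 1) (2 * h + 1) = C / q_poch p p (k - h)"
          using transfer[OF h(2)] transfer[OF h(3)] unfolding j d[OF h(1)] by simp_all
        have S: "closed_form q u (\<not> sp) (2 * h) = x ^ h * p ^ (h * h) / (q_poch p x h * q_poch p p h)"
          "closed_form q u (\<not> sp) (2 * h + 1) = (x * p ^ h) * (x ^ h * p ^ (h * h)) /
            (q_poch p x h * (1 - x * p ^ h) * q_poch p p h)"
          using False by (simp_all only: closed_form_eq simp_thms q_poch_Suc) (simp add: power_add)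
        \<comment> \<open>Here \<open>w\<close> stands for \<open>x * p ^ h\<close>; the indices
          \<open>2 * h\<close> and \<open>2 * h + 1\<close> carry the shares \<open>1 - w\<close>
          and \<open>w\<close>.\<close>
        have "c / d * (s / (a * b)) + c / d * (w * s / (a * (1 - w) * b)) = c * (s / (a * (1 - w) * b * d))"
          if "1 - w \<noteq> 0" "a \<noteq> 0" "b \<noteq> 0" "d \<noteq> 0" for a b c d s w :: real
          using that by (simp add: divide_simps) (simp add: algebra_simps)
        moreover have "1 - x * p ^ h \<noteq> 0"
          using q_poch_parameters_pos(1)[of "Suc h"] by (auto simp: q_poch_Suc)
        ultimately show ?thesis
          using q_poch_parameters_pos[THEN less_imp_neq, symmetric]
          by (simp only: T S if_not_P[OF False] mult_1_left q_poch_Suc not_False_eq_True)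
      qed
    qed
    then show ?thesis
      unfolding closed vandermonde by (simp add: j)
  qed
qed

section \<open>Convergence of the truncated sums and summation over all partitions\<close>

lemma truncated_sum_limit: "(\<lambda>N. truncated_sum q u sp N j) \<longlonglongrightarrow> closed_form q u sp j"
proof (rule coupled_recursion_limit[where A = "column_transfer q u"])
  fix sp j l
  show "0 \<le> column_transfer q u sp j l"
    using q u by (simp add: column_transfer_def local_factor_nonneg)
  show "0 \<le> closed_form q u sp j"
    unfolding closed_form_def p[symmetric] x[symmetric]
    using u q_poch_parameters_pos[THEN less_imp_le] by simp
  show "truncated_sum q u sp 0 j = (if j = 0 then 1 else 0)"
    using q by (simp add: truncated_sum_0)
  show "closed_form q u sp j = (\<Sum>l\<le>j. column_transfer q u sp j l * closed_form q u (\<not> sp) l)"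
    by (rule closed_form_fixed_point)
  show "column_transfer q u sp 0 0 = 1"
    using q by (simp add: column_transfer_def)
  show "closed_form q u sp 0 = 1"
    using q by (simp add: closed_form_def)
next
  fix sp N j
  show "truncated_sum q u sp (Suc N) j = (\<Sum>l\<le>j. column_transfer q u sp j l * truncated_sum q u (\<not> sp) N l)"
    using q by (simp add: truncated_sum_Suc)
next
  fix j :: nat assume "0 < j"
  \<comment> \<open>The linear terms of the two exponents have opposite signs and cancel.\<close>
  have "column_transfer q u True j j * column_transfer q u False j j = (u ^ j)\<^sup>2 * q powr (- (real j)\<^sup>2)"
  proof -
    have "q powr (- ((real j)\<^sup>2 + 1 * real j) / 2) * q powr (- ((real j)\<^sup>2 + - 1 * real j) / 2) = q powr (- (real j)\<^sup>2)"
      by (simp add: powr_add[symmetric] field_simps)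
    then show ?thesis
      by (simp add: column_transfer_eq power2_eq_square[of "u ^ j"] mult_ac)
  qed
  also have "\<dots> \<le> q powr (- (real j)\<^sup>2)"
    using u by (intro mult_left_le_one_le) (auto intro!: power_le_one)
  also have "\<dots> < 1"
    using q \<open>0 < j\<close> by (simp add: powr_less_one)
  finally show "column_transfer q u True j j * column_transfer q u False j j < 1" .
qed

lemma has_sum_weight:
  "((\<lambda>\<mu>. weight q u (local_factor q sp) (sum_mset \<mu>) \<mu>) has_sum closed_form q u sp j)
     {\<mu> \<in> partitions. column_length \<mu> 1 = j}"
proof (rule has_sum_exhaustion)
  fix \<mu>
  show "0 \<le> weight q u (local_factor q sp) (sum_mset \<mu>) \<mu>"
    using q u by (auto simp: weight_def intro!: mult_nonneg_nonneg prod_nonneg local_factor_nonneg)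
next
  show "finite (bounded_partitions n j)" for n
    by (rule finite_bounded_partitions)
  show "incseq (\<lambda>n. bounded_partitions n j)"
    by (fastforce simp: incseq_def bounded_partitions_def)
  have "\<mu> \<in> bounded_partitions (sum_mset \<mu>) j" if "0 \<notin># \<mu>" "size \<mu> = j" for \<mu>
    using that set_mset_subset_sum_mset by (simp add: bounded_partitions_def)
  moreover have "0 \<notin># \<mu> \<and> size \<mu> = j" if "\<mu> \<in> bounded_partitions n j" for n \<mu>
    using that by (auto simp: bounded_partitions_def)
  moreover have "{\<mu> \<in> partitions. column_length \<mu> 1 = j} = {\<mu>. 0 \<notin># \<mu> \<and> size \<mu> = j}"
    using column_length_1 by (auto simp: partitions_def simp del: One_nat_def)
  ultimately show "(\<Union>n. bounded_partitions n j) = {\<mu> \<in> partitions. column_length \<mu> 1 = j}"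
    by blast
  have "(\<Sum>\<mu>\<in>bounded_partitions n j. weight q u (local_factor q sp) (sum_mset \<mu>) \<mu>) = truncated_sum q u sp n j" for n
    unfolding truncated_sum_def using q
    by (intro sum.cong refl weight_sum_mset) (auto simp: bounded_partitions_def)
  with truncated_sum_limit
  show "(\<lambda>n. \<Sum>\<mu>\<in>bounded_partitions n j. weight q u (local_factor q sp) (sum_mset \<mu>) \<mu>) \<longlonglongrightarrow> closed_form q u sp j"
    by simp
qed

lemma P_eq_closed_form:
  "P_Sp q u j = euler_product q u * closed_form q u True j"
  "P_O q u j = euler_product q u / (1 + u) * closed_form q u False j"
proof -
  let ?S = "{\<mu> \<in> partitions. column_length \<mu> 1 = j}"
  have M: "M_Sp q u \<mu> = euler_product q u * weight q u (local_factor q True) (sum_mset \<mu>) \<mu>"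
    "M_O q u \<mu> = euler_product q u / (1 + u) * weight q u (local_factor q False) (sum_mset \<mu>) \<mu>"
    if "\<mu> \<in> ?S" for \<mu>
    using that q by (simp_all add: M_eq_weight partitions_def)
  have "(M_Sp q u has_sum euler_product q u * closed_form q u True j) ?S"
    by (rule has_sum_cong[THEN iffD1, rotated, OF has_sum_cmult_right[OF has_sum_weight]]) (erule M(1)[symmetric])
  then show "P_Sp q u j = euler_product q u * closed_form q u True j"
    unfolding P_Sp_def by (rule infsumI)
  have "(M_O q u has_sum euler_product q u / (1 + u) * closed_form q u False j) ?S"
    by (rule has_sum_cong[THEN iffD1, rotated, OF has_sum_cmult_right[OF has_sum_weight]]) (erule M(2)[symmetric])
  then show "P_O q u j = euler_product q u / (1 + u) * closed_form q u False j"
    unfolding P_O_def by (rule infsumI)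
qed

section \<open>Comparison with the explicit products\<close>

lemma prod_eq_q_poch_parameters:
  "(\<Prod>i=1..n. 1 - u\<^sup>2 / q ^ (2 * i - 1)) = q_poch p x n"
  "(\<Prod>i=1..n. 1 - 1 / q ^ (2 * i)) = q_poch p p n"
  using q unfolding q_poch_def One_nat_def prod.atLeast1_atMost_eq
  by (auto intro!: prod.cong simp: p x power_one_over power_mult power2_eq_square)

lemma powr_minus_nat:
  assumes "c = - real n"
  shows "q powr c = 1 / q ^ n"
  using q by (simp add: assms powr_minus_divide powr_realpow)

lemma closed_form_explicit:
  "closed_form q u True (2 * k) = u ^ (2 * k) / (q ^ (2 * k\<^sup>2 + k) *
     (\<Prod>i=1..k. (1 - u\<^sup>2 / q ^ (2 * i - 1)) * (1 - 1 / q ^ (2 * i))))"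
  "closed_form q u True (2 * k + 1) = u ^ (2 * k + 2) / (q ^ (2 * k\<^sup>2 + 3 * k + 1) *
     (\<Prod>i=1..k+1. 1 - u\<^sup>2 / q ^ (2 * i - 1)) * (\<Prod>i=1..k. 1 - 1 / q ^ (2 * i)))"
  "closed_form q u False (2 * k) = u ^ (2 * k) / (q ^ (2 * k\<^sup>2 - k) *
     (\<Prod>i=1..k. (1 - u\<^sup>2 / q ^ (2 * i - 1)) * (1 - 1 / q ^ (2 * i))))"
  "closed_form q u False (2 * k + 1) = u ^ (2 * k + 1) / (q ^ (2 * k\<^sup>2 + k) *
     (\<Prod>i=1..k+1. 1 - u\<^sup>2 / q ^ (2 * i - 1)) * (\<Prod>i=1..k. 1 - 1 / q ^ (2 * i)))"
proof -
  \<comment> \<open>This makes the natural-number difference \<open>2 * k\<^sup>2 - k\<close> in the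
    exponent exact.\<close>
  have "k \<le> 2 * k\<^sup>2"
    by (cases k) (auto simp: power2_eq_square)
  then have sub: "real (2 * k\<^sup>2 - k) = 2 * (real k)\<^sup>2 - real k"
    by (simp add: of_nat_diff)
  have e: "q powr (- ((real (2 * k))\<^sup>2 + 1 * real (2 * k)) / 2) = 1 / q ^ (2 * k\<^sup>2 + k)"
    "q powr (- ((real (2 * k + 1))\<^sup>2 + 1 * real (2 * k + 1)) / 2) = 1 / q ^ (2 * k\<^sup>2 + 3 * k + 1)"
    "q powr (- ((real (2 * k))\<^sup>2 + - 1 * real (2 * k)) / 2) = 1 / q ^ (2 * k\<^sup>2 - k)"
    "q powr (- ((real (2 * k + 1))\<^sup>2 + - 1 * real (2 * k + 1)) / 2) = 1 / q ^ (2 * k\<^sup>2 + k)"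
    by (rule powr_minus_nat, simp add: sub power2_eq_square field_simps)+
  have d: "(2 * k + 1) div 2 = k" "(2 * k) div 2 = k" "(2 * k + 1 + 1) div 2 = k + 1" by auto
  show "closed_form q u True (2 * k) = u ^ (2 * k) / (q ^ (2 * k\<^sup>2 + k) *
     (\<Prod>i=1..k. (1 - u\<^sup>2 / q ^ (2 * i - 1)) * (1 - 1 / q ^ (2 * i))))"
   "closed_form q u True (2 * k + 1) = u ^ (2 * k + 2) / (q ^ (2 * k\<^sup>2 + 3 * k + 1) *
     (\<Prod>i=1..k+1. 1 - u\<^sup>2 / q ^ (2 * i - 1)) * (\<Prod>i=1..k. 1 - 1 / q ^ (2 * i)))"
  "closed_form q u False (2 * k) = u ^ (2 * k) / (q ^ (2 * k\<^sup>2 - k) *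
     (\<Prod>i=1..k. (1 - u\<^sup>2 / q ^ (2 * i - 1)) * (1 - 1 / q ^ (2 * i))))"
  "closed_form q u False (2 * k + 1) = u ^ (2 * k + 1) / (q ^ (2 * k\<^sup>2 + k) *
     (\<Prod>i=1..k+1. 1 - u\<^sup>2 / q ^ (2 * i - 1)) * (\<Prod>i=1..k. 1 - 1 / q ^ (2 * i)))"
    unfolding closed_form_def p[symmetric] x[symmetric] prod.distrib prod_eq_q_poch_parameters if_True if_False e d
    by (simp_all add: mult.assoc)
qed

end

theorem theorem3:
  fixes q :: nat and u :: real and k :: nat
  assumes "primepow q" and "odd q" and "0 < u" and "u \<le> 1"
  shows "P_Sp (real q) u (2 * k) =
           (\<Prod>i. 1 - u\<^sup>2 / real q ^ (2 * i + 1)) *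
           (u ^ (2 * k) /
             (real q ^ (2 * k\<^sup>2 + k) *
              (\<Prod>i=1..k. (1 - u\<^sup>2 / real q ^ (2 * i - 1)) * (1 - 1 / real q ^ (2 * i)))))
    \<and> P_Sp (real q) u (2 * k + 1) =
           (\<Prod>i. 1 - u\<^sup>2 / real q ^ (2 * i + 1)) *
           (u ^ (2 * k + 2) /
             (real q ^ (2 * k\<^sup>2 + 3 * k + 1) *
              (\<Prod>i=1..k+1. 1 - u\<^sup>2 / real q ^ (2 * i - 1)) *
              (\<Prod>i=1..k. 1 - 1 / real q ^ (2 * i))))
    \<and> P_O (real q) u (2 * k) =
           (\<Prod>i. 1 - u\<^sup>2 / real q ^ (2 * i + 1)) / (1 + u) *
           (u ^ (2 * k) /
             (real q ^ (2 * k\<^sup>2 - k) *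
              (\<Prod>i=1..k. (1 - u\<^sup>2 / real q ^ (2 * i - 1)) * (1 - 1 / real q ^ (2 * i)))))
    \<and> P_O (real q) u (2 * k + 1) =
           (\<Prod>i. 1 - u\<^sup>2 / real q ^ (2 * i + 1)) / (1 + u) *
           (u ^ (2 * k + 1) /
             (real q ^ (2 * k\<^sup>2 + k) *
              (\<Prod>i=1..k+1. 1 - u\<^sup>2 / real q ^ (2 * i - 1)) *
              (\<Prod>i=1..k. 1 - 1 / real q ^ (2 * i))))"
proof -
  have "1 < real q"
    using \<open>primepow q\<close> primepow_gt_Suc_0 by fastforce
  \<comment> \<open>The two \<open>refl\<close> instantiate \<open>p\<close> and \<open>x\<close> by
    their defining expressions.\<close>
  note facts = this \<open>0 < u\<close> \<open>u \<le> 1\<close> refl refl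
  have E: "(\<Prod>i. 1 - u\<^sup>2 / real q ^ (2 * i + 1)) = euler_product (real q) u"
    by (simp add: euler_product_def)
  show ?thesis
    unfolding E P_eq_closed_form[OF facts] closed_form_explicit[OF facts] by blast
qed

end
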